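(* Let $\varphi:Y\to B$ be any of the 14 Weierstrass fibrations listed in the context, over an unspecified smooth compact base $B$ of arbitrary dimension. Let $Q(t)=\frac{t(1+y)}{1-e^{-t(1+y)}}-yt$ be the characteristic power series of the normalized Hirzebruch class and let $R(t)=\ln(Q(t))$. Then the generating function $\chi_y^{\mathrm{str}}(Y;t)$, whose coefficient of $t^d$ is the formula for the stringy $\chi_y$-genus of $Y$ over a base of dimension $d$, namely $$[t^d]\,\chi_y^{\mathrm{str}}(Y;t)=[t^d]\left(\mathcal{Q}_Y(t)\prod_{i=1}^dQ(t\lambda_i)\right)$$ (where $\lambda_1,\dots,\lambda_d$ are the Chern roots of the tangent bundle of a $d$-dimensional base), is given by $$\chi_y^{\mathrm{str}}(Y;t)=\mathcal{Q}_Y(t)\,\exp\left(R(t)\odot\left(\frac{-tC'(t)}{C(t)}\right)\right),$$ where $C(t)=\sum_{i=0}^\infty(-1)^ic_it^i$ with $c_0=1$ and $c_i$ ($i\geq1$) formal variables representing the Chern classes of an arbitrary base $B$.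
   Context: Notation. $[t^k]f(t)$ is the coefficient of $t^k$ in a power series $f$. $\odot$ is the Hadamard product: $(\sum a_it^i)\odot(\sum b_it^i)=\sum a_ib_it^i$. The symmetric expression in $\lambda_1,\dots,\lambda_d$ is rewritten in terms of $c_i=$ the $i$-th elementary symmetric polynomial of $\lambda_1,\dots,\lambda_d$ ($c_i=c_i(B)$); equality of coefficients of $t^d$ is as polynomials in the $c_i$, $L$, $S$. Weierstrass fibrations. Let $\mathscr{L}\to B$ be a line bundle (the fundamental line bundle), $L=c_1(\mathscr{L})$, $\mathscr{E}=\mathscr{O}_B\oplus\mathscr{L}^2\oplus\mathscr{L}^3$, and $\pi:\mathbb{P}(\mathscr{E})\to B$ the projective bundle of lines. Let $x,y,z$ be the tautological sections of $\mathscr{O}(1)\otimes\pi^*\mathscr{L}^2$, $\mathscr{O}(1)\otimes\pi^*\mathscr{L}^3$, $\mathscr{O}(1)$ (this coordinate $y$ is unrelated to the parameter $y$ of the Hirzebruch class). $Y\subset\mathbb{P}(\mathscr{E})$ is the hypersurface given by one of the equations below, $\varphi=\pi|_Y$; here $s$ is a section of $\mathscr{O}(S)$ for a divisor $S$ on $B$, $a_i$ is a section of $\mathscr{L}^i$, $a_{i,j}$ a section of $\mathscr{L}^i\otimes\mathscr{O}(-jS)$; for SO(3), SO(5), SO(6), $S=4L,2L,2L$ respectively. SU(2): $y^2z=x^3+a_{4,1}sxz^2+a_{6,2}s^2z^3$. SU(3): $y^2z+a_{3,1}syz^2=x^3+a_{4,2}s^2xz^2+a_{6,3}s^3z^3$.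 SU(4): $y^2z+a_1xyz=x^3+a_{2,1}sx^2z+a_{4,2}s^2xz^2+a_{6,4}s^4z^3$. SU(5): $y^2z+a_1xyz+a_{3,2}s^2yz^2=x^3+a_{2,1}sx^2z+a_{4,3}s^3xz^2+a_{6,5}s^5z^3$. USp(4): $y^2z=x^3+a_2x^2z+a_{4,3}s^3xz^2+a_{6,5}s^5z^3$. SO(3): $y^2z=x(x^2+a_2xz+sz^2)$. SO(5): $y^2z=x^3+a_2x^2z+s^2xz^2$. SO(6): $y^2z+a_1xyz=x^3+sx^2z+s^2xz^2$. Spin(7): $y^2z=x^3+a_{2,1}sx^2z+a_{4,2}s^2xz^2+a_{6,4}s^4z^3$. $G_2$: $y^2z=x^3+a_{4,2}s^2xz^2+a_{6,3}s^3z^3$. $F_4$: $y^2z=x^3+a_{4,3}s^3xz^2+a_{6,4}s^4z^3$. $E_6$: $y^2z+a_{3,2}s^2yz^2=x^3+a_{4,3}s^3xz^2+a_{6,5}s^5z^3$. $E_7$: $y^2z=x^3+a_{4,3}s^3xz^2+a_{6,5}s^5z^3$. $E_8$: $y^2z=x^3+a_{4,4}s^4xz^2+a_{6,5}s^5z^3$. Each $Y$ is assumed to admit a crepant resolution $\rho:\widetilde Y\to Y$ (known from work of Esole, Jefferson and Kang). Stringy classes. $T_y$ is the multiplicative characteristic class with characteristic power series $Q$; for smooth $V$, $T_y(V)=T_y(TV)\cap[V]$. $T_y^{\mathrm{str}}(Y)=\rho_*T_y(\widetilde Y)$ for a crepant resolution $\rho$ (independent of choice), and $\chi_y^{\mathrm{str}}(Y)=\int_YT_y^{\mathrm{str}}(Y)$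 is the stringy $\chi_y$-genus. The series $\mathcal{Q}_Y(t)$. For each family there is a rational expression $\mathcal{Q}_Y(l,s)$ in $l=e^{(1+y)L}$, $s=e^{(1+y)S}$, independent of $B$, with $\varphi_*T_y^{\mathrm{str}}(Y)=\mathcal{Q}_Y(l,s)T_y(B)$. $\mathcal{Q}_Y(t)$ denotes the power series in $t$ obtained by replacing $l,s$ with $e^{(1+y)tL}$, $e^{(1+y)tS}$. Explicitly, $\mathcal{Q}_Y(l,s)$ is: SU(2): $1-2y+\frac{y+1}{y+s}\big(y+sl\frac{(y+1)(sy-l^4)-y(s-1)l^2}{l^6+s^2y}\big)$. SU(3), USp(4), $G_2$: $1-3y+\frac{y+1}{y+s}\big(2y+sl\frac{(y+1)(s^2y-l^4)-y(s-1)l(l^2+s)}{l^6+s^3y}\big)$. SU(4), Spin(7): $1-4y+\frac{y+1}{y+s}\big(3y+sl\frac{(y+1)(s^5y^2-l^8)-y(s-1)l(s+l)(l^5+s^3y)}{(l^6+s^4y)(l^4+s^2y)}\big)$. SU(5): $1-6y+\frac{y+1}{y+s}\big(5y+\frac{y(s-1)(l^7+s^5y)+sl(y+1)(s^4y^2-l^5-sly(l-1)(l^2+sl+s^2))}{(l+y)(l^6+s^5y)}\big)$. SO(3): $1-2y+(y+1)\frac{(1+l)y-l^3}{l^4+y}$. SO(5): $1-3y+(y+1)\frac{(2-l)y-l}{l^2+y}+\frac{2yl(y+1)^2}{(l^2+y)^2}$. SO(6): $1-5y+(y+1)\frac{(4+l)y-l}{l^2+y}$. $F_4$: $1-5y+\frac{y+1}{y+s}\big(4y+sl\frac{(y+1)(s^3y-l^4)-2y(s-1)l^2s}{l^6+s^4y}\big)$.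 $E_6$: $1-8y+\frac{y+1}{y+s}\big(7y+\frac{y(s-1)(l^9+s^7y)+sl(y+1)(s^3y-l^4)(l^3+s^3y)}{(l^3+s^2y)(l^6+s^5y)}\big)$. $E_7$: $1-9y+\frac{y+1}{y+s}\big(8y+\frac{y(s-1)(l^{10}+s^8y)+sl(y+1)(s^7y^2-l^8)}{(l^4+s^3y)(l^6+s^5y)}\big)$. $E_8$: $1-11y+\frac{y+1}{y+s}\big(10y+\frac{y(s-1)(l^6+s^5)+sl(y+1)(s^4y-l^4)}{l^6+s^5y}\big)$. *)

theory Defs
  imports
    "HOL-Computational_Algebra.Computational_Algebra"
    "HOL-Library.Poly_Mapping"
begin

unbundle fps_syntax

instance fract :: ("{idom, ring_char_0}") field_char_0
proof
  show "inj (of_nat :: nat \<Rightarrow> 'a fract)"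
    by (rule injI) (simp add: of_nat_fract eq_fract)
qed

section \<open>The coefficient rings\<close>

text \<open>
  The parameter \<open>y\<close> of the Hirzebruch class is an indeterminate: the ground field is \<open>\<rat>(y)\<close>.
\<close>

type_synonym ground = "rat poly fract"

definition hirzebruch_y :: ground where
  "hirzebruch_y = to_fract [:0, 1:]"

text \<open>
  Formal variables: \<open>Fund\<close> is \<open>L\<close>, the first Chern class of the fundamental line bundle;
  \<open>Divi\<close> is the class \<open>S\<close>; \<open>Chern i\<close> (for \<open>i \<ge> 1\<close>) is \<open>c\<^sub>i\<close> and \<open>Root i\<close> (for \<open>i \<ge> 1\<close>) is the
  Chern root \<open>\<lambda>\<^sub>i\<close>.  The variables \<open>Chern 0\<close> and \<open>Root 0\<close> are never used, as \<open>c\<^sub>0 = 1\<close>.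
\<close>

datatype indet = Fund | Divi | Chern nat | Root nat

text \<open>
  The order on the variables has no mathematical meaning here; the library needs one to know that
  polynomials over a field form an integral domain.
\<close>

fun indet_code :: "indet \<Rightarrow> nat" where
  "indet_code Fund = 0"
| "indet_code Divi = 1"
| "indet_code (Chern i) = 2 * i + 2"
| "indet_code (Root i) = 2 * i + 3"

lemma indet_code_inject: "indet_code a = indet_code b \<longleftrightarrow> a = b"
  by (cases a; cases b) (simp_all, presburger+)

instantiation indet :: linorder
begin

definition less_eq_indet :: "indet \<Rightarrow> indet \<Rightarrow> bool" where
  "less_eq_indet a b \<longleftrightarrow> indet_code a \<le> indet_code b"

definition less_indet :: "indet \<Rightarrow> indet \<Rightarrow> bool" where
  "less_indet a b \<longleftrightarrow> indet_code a < indet_code b"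

instance
  by standard (auto simp: less_eq_indet_def less_indet_def indet_code_inject)

end

text \<open>Polynomials over \<open>\<rat>(y)\<close> in all these variables: finitely supported maps from monomials
  to coefficients, with the convolution product.\<close>

type_synonym mpoly = "(indet \<Rightarrow>\<^sub>0 nat) \<Rightarrow>\<^sub>0 ground"

text \<open>The library's composition, logarithm, exponential and division of power series are
  formulated over fields, so the power series in \<open>t\<close> have coefficients in the field of fractions
  of the polynomial ring.\<close>

type_synonym mfrac = "mpoly fract"

definition pconst :: "ground \<Rightarrow> mpoly" where
  "pconst a = Poly_Mapping.single 0 a"

definition pvar :: "indet \<Rightarrow> mpoly" where
  "pvar v = Poly_Mapping.single (Poly_Mapping.single v 1) 1"

definition pvars :: "mpoly \<Rightarrow> indet set" where
  "pvars p = (\<Union>m\<in>Poly_Mapping.keys p. Poly_Mapping.keys m)"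

definition psubst :: "(indet \<Rightarrow> mpoly) \<Rightarrow> mpoly \<Rightarrow> mpoly" where
  "psubst \<sigma> p =
     (\<Sum>m\<in>Poly_Mapping.keys p. pconst (Poly_Mapping.lookup p m) *
        (\<Prod>v\<in>Poly_Mapping.keys m. \<sigma> v ^ Poly_Mapping.lookup m v))"

definition fy :: mfrac where "fy = to_fract (pconst hirzebruch_y)"
definition fvar :: "indet \<Rightarrow> mfrac" where "fvar v = to_fract (pvar v)"

section \<open>The normalized Hirzebruch class\<close>

text \<open>\<open>Q(t) = t(1+y) / (1 - e\<^sup>-\<^sup>t\<^sup>(\<^sup>1\<^sup>+\<^sup>y\<^sup>)) - yt\<close>.  Numerator and denominator of the quotient both have
  order one, and the division of power series over a field cancels the common factor \<open>t\<close>.\<close>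

definition hirzebruch_Q :: "mfrac fps" where
  "hirzebruch_Q =
     fps_X * fps_const (1 + fy) / (1 - fps_exp (- (1 + fy))) - fps_const fy * fps_X"

text \<open>\<open>R(t) = ln Q(t)\<close>; note that \<open>fps_ln 1\<close> is the series of \<open>ln (1 + t)\<close>, and \<open>Q(0) = 1\<close>.\<close>

definition hirzebruch_R :: "mfrac fps" where
  "hirzebruch_R = fps_ln 1 oo (hirzebruch_Q - 1)"

definition hadamard :: "'a::times fps \<Rightarrow> 'a fps \<Rightarrow> 'a fps" (infixl \<open>\<odot>\<close> 70) where
  "f \<odot> g = Abs_fps (\<lambda>n. f $ n * g $ n)"

definition chern_C :: "mfrac fps" where
  "chern_C = Abs_fps (\<lambda>i. (- 1) ^ i * (if i = 0 then 1 else fvar (Chern i)))"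

section \<open>The Weierstrass fibrations\<close>

datatype fibration =
  SU2 | SU3 | SU4 | SU5 | USp4 | SO3 | SO5 | SO6 | Spin7 | G2 | F4 | E6 | E7 | E8

text \<open>
  The rational expression \<open>\<Q>\<^sub>Y(l,s)\<close> with \<open>\<phi>\<^sub>* T\<^sub>y\<^sup>s\<^sup>t\<^sup>r(Y) = \<Q>\<^sub>Y(l,s) T\<^sub>y(B)\<close>, where
  \<open>l = e\<^sup>(\<^sup>1\<^sup>+\<^sup>y\<^sup>)\<^sup>L\<close> and \<open>s = e\<^sup>(\<^sup>1\<^sup>+\<^sup>y\<^sup>)\<^sup>S\<close>.  For the groups \<open>SO(3)\<close>, \<open>SO(5)\<close>, \<open>SO(6)\<close> the class \<open>S\<close> is a multiple
  of \<open>L\<close> and \<open>s\<close> does not occur.  It is stated for arbitrary commutative rings with division, as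
  it is to be evaluated at power series; all denominators are then units.
\<close>

fun fibration_Q ::
    "fibration \<Rightarrow> 'a \<Rightarrow> 'a \<Rightarrow> 'a \<Rightarrow> 'a::{comm_ring_1, inverse}" where
  "fibration_Q SU2 y l s =
     1 - 2*y + (y+1) / (y+s) *
       (y + s*l * (((y+1)*(s*y - l^4) - y*(s-1)*l^2) / (l^6 + s^2*y)))"
| "fibration_Q SU3 y l s =
     1 - 3*y + (y+1) / (y+s) *
       (2*y + s*l * (((y+1)*(s^2*y - l^4) - y*(s-1)*l*(l^2+s)) / (l^6 + s^3*y)))"
| "fibration_Q USp4 y l s =
     1 - 3*y + (y+1) / (y+s) *
       (2*y + s*l * (((y+1)*(s^2*y - l^4) - y*(s-1)*l*(l^2+s)) / (l^6 + s^3*y)))"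
| "fibration_Q G2 y l s =
     1 - 3*y + (y+1) / (y+s) *
       (2*y + s*l * (((y+1)*(s^2*y - l^4) - y*(s-1)*l*(l^2+s)) / (l^6 + s^3*y)))"
| "fibration_Q SU4 y l s =
     1 - 4*y + (y+1) / (y+s) *
       (3*y + s*l * (((y+1)*(s^5*y^2 - l^8) - y*(s-1)*l*(s+l)*(l^5 + s^3*y)) /
                     ((l^6 + s^4*y)*(l^4 + s^2*y))))"
| "fibration_Q Spin7 y l s =
     1 - 4*y + (y+1) / (y+s) *
       (3*y + s*l * (((y+1)*(s^5*y^2 - l^8) - y*(s-1)*l*(s+l)*(l^5 + s^3*y)) /
                     ((l^6 + s^4*y)*(l^4 + s^2*y))))"
| "fibration_Q SU5 y l s =
     1 - 6*y + (y+1) / (y+s) *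
       (5*y + (y*(s-1)*(l^7 + s^5*y)
                + s*l*(y+1)*(s^4*y^2 - l^5 - s*l*y*(l-1)*(l^2 + s*l + s^2))) /
              ((l+y)*(l^6 + s^5*y)))"
| "fibration_Q SO3 y l s =
     1 - 2*y + (y+1) * (((1+l)*y - l^3) / (l^4 + y))"
| "fibration_Q SO5 y l s =
     1 - 3*y + (y+1) * (((2-l)*y - l) / (l^2 + y))
       + (2*y*l*(y+1)^2) / (l^2 + y)^2"
| "fibration_Q SO6 y l s =
     1 - 5*y + (y+1) * (((4+l)*y - l) / (l^2 + y))"
| "fibration_Q F4 y l s =
     1 - 5*y + (y+1) / (y+s) *
       (4*y + s*l * (((y+1)*(s^3*y - l^4) - 2*y*(s-1)*l^2*s) / (l^6 + s^4*y)))"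
| "fibration_Q E6 y l s =
     1 - 8*y + (y+1) / (y+s) *
       (7*y + (y*(s-1)*(l^9 + s^7*y) + s*l*(y+1)*(s^3*y - l^4)*(l^3 + s^3*y)) /
              ((l^3 + s^2*y)*(l^6 + s^5*y)))"
| "fibration_Q E7 y l s =
     1 - 9*y + (y+1) / (y+s) *
       (8*y + (y*(s-1)*(l^10 + s^8*y) + s*l*(y+1)*(s^7*y^2 - l^8)) /
              ((l^4 + s^3*y)*(l^6 + s^5*y)))"
| "fibration_Q E8 y l s =
     1 - 11*y + (y+1) / (y+s) *
       (10*y + (y*(s-1)*(l^6 + s^5) + s*l*(y+1)*(s^4*y - l^4)) / (l^6 + s^5*y))"

text \<open>\<open>\<Q>\<^sub>Y(t)\<close>: here \<open>fps_exp a\<close> is the series of \<open>e\<^sup>a\<^sup>t\<close>.\<close>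

definition fibration_series :: "fibration \<Rightarrow> mfrac fps" where
  "fibration_series Y =
     fibration_Q Y (fps_const fy)
       (fps_exp ((1 + fy) * fvar Fund)) (fps_exp ((1 + fy) * fvar Divi))"

section \<open>The generating function of the stringy \<open>\<chi>\<^sub>y\<close>-genus\<close>

text \<open>The formula for \<open>\<chi>\<^sub>y\<^sup>s\<^sup>t\<^sup>r(Y)\<close> over a base of dimension \<open>d\<close> in terms of the Chern roots
  \<open>\<lambda>\<^sub>1, \<dots>, \<lambda>\<^sub>d\<close>, namely \<open>[t\<^sup>d] \<Q>\<^sub>Y(t) \<Prod>\<^sub>i Q(t \<lambda>\<^sub>i)\<close>.\<close>

definition chi_roots :: "fibration \<Rightarrow> nat \<Rightarrow> mfrac" where
  "chi_roots Y d =
     (fibration_series Y *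
        (\<Prod>i=1..d. hirzebruch_Q oo (fps_const (fvar (Root i)) * fps_X))) $ d"

definition elem_sym_roots :: "nat \<Rightarrow> nat \<Rightarrow> mpoly" where
  "elem_sym_roots d i =
     (\<Sum>I\<in>{I. I \<subseteq> {1..d} \<and> card I = i}. \<Prod>j\<in>I. pvar (Root j))"

fun chern_to_roots :: "nat \<Rightarrow> indet \<Rightarrow> mpoly" where
  "chern_to_roots d (Chern i) = elem_sym_roots d i"
| "chern_to_roots d v = pvar v"

text \<open>The polynomial \<open>p\<close> in \<open>L\<close>, \<open>S\<close>, \<open>c\<^sub>1, \<dots>, c\<^sub>d\<close> is the expression \<open>f\<close> in the Chern roots
  \<open>\<lambda>\<^sub>1, \<dots>, \<lambda>\<^sub>d\<close> rewritten in terms of their elementary symmetric polynomials \<open>c\<^sub>i\<close>.\<close>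

definition rewritten_in_chern :: "nat \<Rightarrow> mfrac \<Rightarrow> mpoly \<Rightarrow> bool" where
  "rewritten_in_chern d f p \<longleftrightarrow>
     pvars p \<subseteq> {Fund, Divi} \<union> Chern ` {1..d} \<and>
     to_fract (psubst (chern_to_roots d) p) = f"

text \<open>\<open>\<chi>\<close> is the generating function of \<open>Y\<close>: for each \<open>d\<close> its coefficient of \<open>t\<^sup>d\<close> is the formula for
  the stringy \<open>\<chi>\<^sub>y\<close>-genus over a base of dimension \<open>d\<close>, as a polynomial in \<open>L\<close>, \<open>S\<close> and the \<open>c\<^sub>i\<close>.\<close>

definition is_stringy_chi_y_series :: "fibration \<Rightarrow> mfrac fps \<Rightarrow> bool" where
  "is_stringy_chi_y_series Y \<chi> \<longleftrightarrow>
     (\<forall>d. \<exists>p. \<chi> $ d = to_fract p \<and> rewritten_in_chern d (chi_roots Y d) p)"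

end

theory Submission
  imports Defs
begin

text \<open>
  Substituting the elementary symmetric polynomials of \<open>\<lambda>\<^sub>1, \<dots>, \<lambda>\<^sub>d\<close> for the Chern classes turns
  \<open>C(t)\<close> into \<open>E(t) = \<Prod>\<^sub>i (1 - \<lambda>\<^sub>i t)\<close> up to order \<open>d\<close>, and this substitution commutes with all the
  operations on power series involved. Now \<open>- t E'(t) / E(t) = \<Sum>\<^sub>i \<Sum>\<^sub>n\<^sub>\<ge>\<^sub>1 \<lambda>\<^sub>i\<^sup>n t\<^sup>n\<close>, so its Hadamard product with
  \<open>R\<close> is \<open>\<Sum>\<^sub>i R(\<lambda>\<^sub>i t)\<close>, the exponential of which is \<open>\<Prod>\<^sub>i Q(\<lambda>\<^sub>i t)\<close>. The converse is the algebraic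
  independence of the elementary symmetric polynomials, which makes the rewriting unique.
\<close>

section \<open>Polynomials and substitution\<close>

lemma pconst_0 [simp]: "pconst 0 = 0"
  and pconst_1 [simp]: "pconst 1 = 1"
  and pconst_add: "pconst (a + b) = pconst a + pconst b"
  and pconst_uminus: "pconst (- a) = - pconst a"
  and pconst_mult: "pconst (a * b) = pconst a * pconst b"
  by (simp_all add: pconst_def single_add single_uminus mult_single)

lemma pconst_eq_0_iff [simp]: "pconst a = 0 \<longleftrightarrow> a = 0"
  by (metis pconst_def lookup_single_eq lookup_zero single_zero)

lemma mpoly_eq_sum_single:
  "p = (\<Sum>m\<in>Poly_Mapping.keys p. Poly_Mapping.single m (Poly_Mapping.lookup p m))"
proof (rule poly_mapping_eqI)
  fix k
  show "Poly_Mapping.lookup p k = Poly_Mapping.lookup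
      (\<Sum>m\<in>Poly_Mapping.keys p. Poly_Mapping.single m (Poly_Mapping.lookup p m)) k"
    by (auto simp: lookup_sum lookup_single when_def in_keys_iff
        intro: sum.neutral)
qed

text \<open>The part of \<open>psubst\<close> that depends on the exponents alone. It turns sums of
  exponents into products, so multiplicativity of \<open>psubst\<close> reduces to
  \<open>monom_subst_add\<close>.\<close>

definition monom_subst :: "(indet \<Rightarrow> mpoly) \<Rightarrow> (indet \<Rightarrow>\<^sub>0 nat) \<Rightarrow> mpoly" where
  "monom_subst \<sigma> m = (\<Prod>v\<in>Poly_Mapping.keys m. \<sigma> v ^ Poly_Mapping.lookup m v)"

text \<open>Additional variables contribute factors with exponent zero, so two monomials can be
  expanded over one common set of variables.\<close>

lemma monom_subst_superset:
  assumes "finite S" "Poly_Mapping.keys m \<subseteq> S"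
  shows "monom_subst \<sigma> m = (\<Prod>v\<in>S. \<sigma> v ^ Poly_Mapping.lookup m v)"
  unfolding monom_subst_def
  by (rule prod.mono_neutral_left) (use assms in \<open>auto simp: in_keys_iff\<close>)

lemma monom_subst_0 [simp]: "monom_subst \<sigma> 0 = 1"
  by (simp add: monom_subst_def)

lemma monom_subst_add: "monom_subst \<sigma> (m + n) = monom_subst \<sigma> m * monom_subst \<sigma> n"
proof -
  let ?S = "Poly_Mapping.keys m \<union> Poly_Mapping.keys n"
  have "monom_subst \<sigma> (m + n) = (\<Prod>v\<in>?S. \<sigma> v ^ Poly_Mapping.lookup (m + n) v)"
    by (rule monom_subst_superset) (simp_all add: keys_add)
  also have "\<dots> = monom_subst \<sigma> m * monom_subst \<sigma> n"
    by (simp add: monom_subst_superset[of ?S m] monom_subst_superset[of ?S n]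
        lookup_add power_add prod.distrib)
  finally show ?thesis .
qed

lemma psubst_conv_monom_subst:
  "psubst \<sigma> p = (\<Sum>m\<in>Poly_Mapping.keys p. pconst (Poly_Mapping.lookup p m) * monom_subst \<sigma> m)"
  by (simp add: psubst_def monom_subst_def)

lemma psubst_single [simp]: "psubst \<sigma> (Poly_Mapping.single m a) = pconst a * monom_subst \<sigma> m"
  by (simp add: psubst_conv_monom_subst)

lemma psubst_0 [simp]: "psubst \<sigma> 0 = 0"
  by (simp add: psubst_conv_monom_subst)

lemma psubst_add [simp]: "psubst \<sigma> (p + q) = psubst \<sigma> p + psubst \<sigma> q"
  unfolding psubst_conv_monom_subst
  by (rule setsum_keys_plus_distrib) (simp_all add: pconst_add distrib_right)

lemma psubst_uminus [simp]: "psubst \<sigma> (- p) = - psubst \<sigma> p"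
  using psubst_add[of \<sigma> p "- p"] by (simp add: eq_neg_iff_add_eq_0 add.commute)

lemma psubst_sum: "psubst \<sigma> (sum f A) = (\<Sum>x\<in>A. psubst \<sigma> (f x))"
  by (induction A rule: infinite_finite_induct) simp_all

text \<open>Expanding both factors into monomials avoids describing the keys of the product, where
  terms may cancel.\<close>

lemma psubst_mult [simp]: "psubst \<sigma> (p * q) = psubst \<sigma> p * psubst \<sigma> q"
proof -
  define M N where "M = Poly_Mapping.keys p" and "N = Poly_Mapping.keys q"
  have "p * q = (\<Sum>m\<in>M. Poly_Mapping.single m (Poly_Mapping.lookup p m)) *
    (\<Sum>n\<in>N. Poly_Mapping.single n (Poly_Mapping.lookup q n))"
    unfolding M_def N_def by (simp flip: mpoly_eq_sum_single)
  then have "psubst \<sigma> (p * q) = (\<Sum>m\<in>M. \<Sum>n\<in>N.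
      pconst (Poly_Mapping.lookup p m) * monom_subst \<sigma> m *
      (pconst (Poly_Mapping.lookup q n) * monom_subst \<sigma> n))"
    by (simp add: sum_product psubst_sum mult_single pconst_mult monom_subst_add mult_ac)
  then show ?thesis
    by (simp add: psubst_conv_monom_subst M_def N_def sum_product)
qed

lemma psubst_pconst [simp]: "psubst \<sigma> (pconst a) = pconst a"
  by (simp add: pconst_def[of a])

lemma psubst_1 [simp]: "psubst \<sigma> 1 = 1"
  using psubst_pconst[of \<sigma> 1] by simp

lemma psubst_pvar [simp]: "psubst \<sigma> (pvar v) = \<sigma> v"
  by (simp add: pvar_def monom_subst_def)

lemma psubst_power [simp]: "psubst \<sigma> (p ^ n) = psubst \<sigma> p ^ n"
  by (induction n) simp_all

lemma psubst_prod: "psubst \<sigma> (prod f A) = (\<Prod>x\<in>A. psubst \<sigma> (f x))"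
  by (induction A rule: infinite_finite_induct) simp_all

lemma psubst_psubst: "psubst \<rho> (psubst \<sigma> p) = psubst (\<lambda>v. psubst \<rho> (\<sigma> v)) p"
  by (subst (2) psubst_def) (simp add: psubst_sum psubst_prod psubst_def[of "\<lambda>v. psubst \<rho> (\<sigma> v)"])

lemma psubst_cong:
  assumes "\<And>v. v \<in> pvars p \<Longrightarrow> \<sigma> v = \<rho> v"
  shows "psubst \<sigma> p = psubst \<rho> p"
  unfolding psubst_def using assms
  by (intro sum.cong prod.cong arg_cong2[where f = "(*)"] arg_cong2[where f = "(^)"] refl)
    (auto simp: pvars_def)

lemma pvar_power: "pvar v ^ k = Poly_Mapping.single (Poly_Mapping.single v k) 1"
  by (induction k) (simp_all add: pvar_def mult_single flip: single_add)

lemma monom_subst_pvar: "monom_subst pvar m = Poly_Mapping.single m 1"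
proof -
  have "(\<Prod>v\<in>A. pvar v ^ Poly_Mapping.lookup m v) =
      Poly_Mapping.single (\<Sum>v\<in>A. Poly_Mapping.single v (Poly_Mapping.lookup m v)) 1"
    if "finite A" for A
    using that by (induction A) (simp_all add: pvar_power mult_single)
  moreover have "(\<Sum>v\<in>Poly_Mapping.keys m. Poly_Mapping.single v (Poly_Mapping.lookup m v)) = m"
    by (rule poly_mapping_eqI)
      (auto simp: lookup_sum lookup_single when_def in_keys_iff intro: sum.neutral)
  ultimately show ?thesis
    by (simp add: monom_subst_def)
qed

lemma psubst_pvar_id [simp]: "psubst pvar p = p"
proof -
  have "psubst pvar p = (\<Sum>m\<in>Poly_Mapping.keys p. Poly_Mapping.single m (Poly_Mapping.lookup p m))"
    by (simp add: psubst_conv_monom_subst monom_subst_pvar pconst_def mult_single)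
  then show ?thesis
    by (simp flip: mpoly_eq_sum_single)
qed

section \<open>Variables occurring in a polynomial\<close>

lemma pvars_0 [simp]: "pvars 0 = {}"
  and pvars_pconst [simp]: "pvars (pconst a) = {}"
  and pvars_pvar [simp]: "pvars (pvar v) = {v}"
  and pvars_uminus [simp]: "pvars (- p) = pvars p"
  by (simp_all add: pvars_def pconst_def pvar_def)

lemma pvars_single_subset: "pvars (Poly_Mapping.single m a) \<subseteq> Poly_Mapping.keys m"
  by (simp add: pvars_def)

lemma pvars_add: "pvars (p + q) \<subseteq> pvars p \<union> pvars q"
  unfolding pvars_def using keys_add[of p q] by blast

lemma pvars_mult: "pvars (p * q) \<subseteq> pvars p \<union> pvars q"
proof
  fix v assume "v \<in> pvars (p * q)"
  then obtain m where "m \<in> Poly_Mapping.keys (p * q)" "v \<in> Poly_Mapping.keys m"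
    by (auto simp: pvars_def)
  then obtain a b where "a \<in> Poly_Mapping.keys p" "b \<in> Poly_Mapping.keys q"
    "v \<in> Poly_Mapping.keys (a + b)"
    using keys_mult[of p q] by blast
  then show "v \<in> pvars p \<union> pvars q"
    using keys_add[of a b] by (auto simp: pvars_def)
qed

lemma pvars_sum: "pvars (sum f A) \<subseteq> (\<Union>x\<in>A. pvars (f x))"
proof (induction A rule: infinite_finite_induct)
  case (insert x A)
  then show ?case using pvars_add[of "f x" "sum f A"] by auto
qed auto

text \<open>Grouping the monomials by their exponent of \<open>v\<close> makes \<open>p\<close> a
  univariate polynomial in \<open>v\<close>. Induction on its coefficients then eliminates the last
  Chern class.\<close>

lemma mpoly_eq_poly_in_pvar:
  assumes "pvars p \<subseteq> insert v V" "v \<notin> V"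
  obtains P :: "mpoly poly" where "p = poly P (pvar v)" "\<And>i. pvars (coeff P i) \<subseteq> V"
proof -
  \<comment> \<open>\<open>del m\<close> is \<open>m\<close> without its power of \<open>v\<close>;
    the removed exponent becomes the degree in \<open>P\<close>.\<close>
  define del where "del m = Poly_Mapping.update v 0 m" for m :: "indet \<Rightarrow>\<^sub>0 nat"
  define P where "P = (\<Sum>m\<in>Poly_Mapping.keys p.
    monom (Poly_Mapping.single (del m) (Poly_Mapping.lookup p m)) (Poly_Mapping.lookup m v))"
  have del: "del m + Poly_Mapping.single v (Poly_Mapping.lookup m v) = m" for m
    by (rule poly_mapping_eqI) (simp add: del_def lookup_add lookup_update lookup_single when_def)
  have "poly P (pvar v) = (\<Sum>m\<in>Poly_Mapping.keys p. Poly_Mapping.single m (Poly_Mapping.lookup p m))"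
    by (simp add: P_def poly_sum poly_monom pvar_power mult_single del)
  then have "p = poly P (pvar v)"
    by (simp flip: mpoly_eq_sum_single)
  moreover have "pvars (coeff P i) \<subseteq> V" for i
  proof -
    have "pvars (coeff (monom (Poly_Mapping.single (del m) (Poly_Mapping.lookup p m)) k) i) \<subseteq> V"
      if "m \<in> Poly_Mapping.keys p" for m k
    proof -
      have "Poly_Mapping.keys (del m) \<subseteq> V"
        using that assms by (force simp: del_def keys_update pvars_def)
      then show ?thesis
        using pvars_single_subset[of "del m"] by auto
    qed
    then show ?thesis
      unfolding P_def coeff_sum by (intro order_trans[OF pvars_sum] UN_least)
  qed
  ultimately show ?thesis
    using that by blast
qed

section \<open>Algebraic independence of the elementary symmetric polynomials\<close>

lemma elem_sym_roots_0 [simp]: "elem_sym_roots d 0 = 1"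
proof -
  have "{I. I \<subseteq> {1..d} \<and> card I = 0} = {{}}"
    using finite_subset[of _ "{1..d}"] by auto
  then show ?thesis
    by (simp add: elem_sym_roots_def)
qed

lemma elem_sym_roots_eq_0:
  assumes "d < i"
  shows "elem_sym_roots d i = 0"
proof -
  have "{I. I \<subseteq> {1..d} \<and> card I = i} = {}"
    using assms card_mono[of "{1..d}"] by (force simp flip: not_le)
  then show ?thesis
    by (simp only: elem_sym_roots_def sum.empty)
qed

lemma elem_sym_roots_same: "elem_sym_roots d d = (\<Prod>j = 1..d. pvar (Root j))"
proof -
  have "{I. I \<subseteq> {1..d} \<and> card I = d} = {{1..d}}"
    using card_subset_eq[of "{1..d}"] by auto
  then show ?thesis
    by (simp add: elem_sym_roots_def)
qed

text \<open>An index set containing \<open>Suc d\<close> yields a vanishing product; the other index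
  sets are the subsets of \<open>{1..d}\<close>.\<close>

lemma psubst_elem_sym_roots_last_root_0:
  "psubst (pvar(Root (Suc d) := 0)) (elem_sym_roots (Suc d) i) = elem_sym_roots d i"
proof -
  let ?\<sigma> = "pvar(Root (Suc d) := 0)"
  have "psubst ?\<sigma> (elem_sym_roots (Suc d) i) =
      (\<Sum>I\<in>{I. I \<subseteq> {1..Suc d} \<and> card I = i}. \<Prod>j\<in>I. ?\<sigma> (Root j))"
    by (simp add: elem_sym_roots_def psubst_sum psubst_prod)
  also have "\<dots> = elem_sym_roots d i"
    unfolding elem_sym_roots_def
  proof (rule sum.mono_neutral_cong_right)
    show "finite {I. I \<subseteq> {1..Suc d} \<and> card I = i}"
      by (rule finite_subset[of _ "Pow {1..Suc d}"]) auto
    show "{I. I \<subseteq> {1..d} \<and> card I = i} \<subseteq> {I. I \<subseteq> {1..Suc d} \<and> card I = i}"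
      by auto
    show "\<forall>I\<in>{I. I \<subseteq> {1..Suc d} \<and> card I = i} - {I. I \<subseteq> {1..d} \<and> card I = i}.
        (\<Prod>j\<in>I. ?\<sigma> (Root j)) = 0"
    proof
      fix I
      assume "I \<in> {I. I \<subseteq> {1..Suc d} \<and> card I = i} - {I. I \<subseteq> {1..d} \<and> card I = i}"
      then have I: "I \<subseteq> {1..Suc d}" and "\<not> I \<subseteq> {1..d}"
        by auto
      then have "Suc d \<in> I"
        by (auto simp: subset_iff le_Suc_eq)
      moreover have "finite I"
        using I finite_subset by blast
      ultimately show "(\<Prod>j\<in>I. ?\<sigma> (Root j)) = 0"
        by (intro prod_zero bexI[of _ "Suc d"]) auto
    qed
    show "(\<Prod>j\<in>I. ?\<sigma> (Root j)) = (\<Prod>j\<in>I. pvar (Root j))"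
      if "I \<in> {I. I \<subseteq> {1..d} \<and> card I = i}" for I
      using that by (intro prod.cong) auto
  qed
  finally show ?thesis .
qed

lemma pvar_neq_0 [simp]: "pvar v \<noteq> 0"
  using pvars_pvar[of v] by force

text \<open>
  Setting the last root to zero turns the elementary symmetric polynomials in \<open>d + 1\<close> roots into
  those in \<open>d\<close> roots and kills the last one. So a relation among them has a constant coefficient,
  with respect to its last variable, that is a relation in \<open>d\<close> roots, hence zero, and the last
  variable can be divided out.
\<close>

lemma psubst_chern_to_roots_eq_0:
  assumes "pvars p \<subseteq> {Fund, Divi} \<union> Chern ` {1..d}" "psubst (chern_to_roots d) p = 0"
  shows "p = 0"
  using assms
proof (induction d arbitrary: p)
  case 0
  have "psubst (chern_to_roots 0) p = psubst pvar p"
    by (rule psubst_cong) (use "0.prems" in auto)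
  with "0.prems" show ?case
    by simp
next
  case (Suc d)
  let ?V = "{Fund, Divi} \<union> Chern ` {1..d}" and ?v = "Chern (Suc d)"
  have "pvars p \<subseteq> insert ?v ?V"
    using Suc.prems(1) by (auto simp: atLeastAtMostSuc_conv)
  moreover have "?v \<notin> ?V"
    by auto
  ultimately obtain P where P: "p = poly P (pvar ?v)" "\<And>i. pvars (coeff P i) \<subseteq> ?V"
    by (rule mpoly_eq_poly_in_pvar) blast
  \<comment> \<open>Stated for every coefficient polynomial, since the induction divides out the
    last Chern class one factor at a time.\<close>
  have "P = 0"
    if "\<And>i. pvars (coeff P i) \<subseteq> ?V" "psubst (chern_to_roots (Suc d)) (poly P (pvar ?v)) = 0"
    for P
    using that
  proof (induction P)
    case (pCons a P)
    let ?\<tau> = "chern_to_roots (Suc d)" and ?\<sigma> = "pvar(Root (Suc d) := 0)"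
    have a: "pvars a \<subseteq> ?V"
      using pCons.prems(1)[of 0] by simp
    have *: "psubst ?\<tau> a + elem_sym_roots (Suc d) (Suc d) * psubst ?\<tau> (poly P (pvar ?v)) = 0"
      using pCons.prems(2) by simp
    have "psubst ?\<sigma> (psubst ?\<tau> a) = psubst (chern_to_roots d) a"
      unfolding psubst_psubst
      by (rule psubst_cong) (use a in \<open>auto simp: psubst_elem_sym_roots_last_root_0\<close>)
    then have "psubst (chern_to_roots d) a = 0"
      using arg_cong[OF *, of "psubst ?\<sigma>"]
      by (simp add: psubst_elem_sym_roots_last_root_0 elem_sym_roots_eq_0)
    with a have "a = 0"
      by (rule Suc.IH)
    moreover have "elem_sym_roots (Suc d) (Suc d) \<noteq> 0"
      by (simp only: elem_sym_roots_same) simp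
    ultimately have "psubst ?\<tau> (poly P (pvar ?v)) = 0"
      using * by simp
    moreover have "pvars (coeff P i) \<subseteq> ?V" for i
      using pCons.prems(1)[of "Suc i"] by simp
    ultimately show ?case
      using pCons.IH \<open>a = 0\<close> by simp
  qed simp
  from this[OF P(2)] P(1) Suc.prems(2) show ?case
    by simp
qed

text \<open>The difference of two rewritings is a relation among the elementary symmetric
  polynomials, hence zero.\<close>

lemma rewritten_in_chern_unique:
  assumes "rewritten_in_chern d f p" "rewritten_in_chern d f q"
  shows "p = q"
proof -
  have "pvars (p + - q) \<subseteq> pvars p \<union> pvars q"
    using pvars_add[of p "- q"] by simp
  also have "\<dots> \<subseteq> {Fund, Divi} \<union> Chern ` {1..d}"
    using assms by (simp only: rewritten_in_chern_def Un_least)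
  finally have "pvars (p + - q) \<subseteq> {Fund, Divi} \<union> Chern ` {1..d}" .
  moreover have "to_fract (psubst (chern_to_roots d) p) = to_fract (psubst (chern_to_roots d) q)"
    using assms by (simp only: rewritten_in_chern_def)
  then have "psubst (chern_to_roots d) (p + - q) = 0"
    by (simp only: to_fract_eq_iff psubst_add psubst_uminus right_minus)
  ultimately have "p + - q = 0"
    by (rule psubst_chern_to_roots_eq_0)
  then show ?thesis
    by simp
qed

section \<open>Exponentials of Hadamard products with logarithmic derivatives\<close>

text \<open>The quotient \<open>u / v\<close> has derivative zero and constant term 1: a linear
  differential equation with given initial value has one solution.\<close>

lemma fps_eq_of_same_logderiv:
  fixes u v :: "'a::field_char_0 fps"
  assumes "fps_deriv u = h * u" "fps_deriv v = h * v" "u $ 0 = v $ 0" "v $ 0 \<noteq> 0"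
  shows "u = v"
proof -
  have "fps_deriv (u * inverse v) = 0"
    using assms by (simp add: fps_inverse_deriv inverse_mult_eq_1' power2_eq_square algebra_simps)
  then have "u * inverse v = fps_const ((u * inverse v) $ 0)"
    using fps_deriv_eq_0_iff by blast
  also have "\<dots> = 1"
    using assms by simp
  finally have "u * inverse v * v = v"
    by simp
  then show ?thesis
    using assms(4) by (simp add: mult.assoc inverse_mult_eq_1)
qed

text \<open>Both sides have logarithmic derivative \<open>fps_deriv (f + g)\<close> and constant
  term 1.\<close>

lemma fps_exp_compose_add:
  fixes f g :: "'a::field_char_0 fps"
  assumes "f $ 0 = 0" "g $ 0 = 0"
  shows "fps_exp 1 oo (f + g) = (fps_exp 1 oo f) * (fps_exp 1 oo g)"
  by (rule fps_eq_of_same_logderiv[where h = "fps_deriv (f + g)"])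
    (use assms in \<open>simp_all add: fps_compose_deriv algebra_simps\<close>)

lemma fps_exp_compose_ln_compose:
  fixes f :: "'a::field_char_0 fps"
  assumes "f $ 0 = 0"
  shows "fps_exp 1 oo (fps_ln 1 oo f) = 1 + f"
proof -
  \<comment> \<open>The series of \<open>ln (1 + t)\<close> is the compositional inverse of
    \<open>exp t - 1\<close>, not of \<open>exp t\<close>.\<close>
  have "(fps_exp 1 - 1) oo (fps_ln 1 oo f) = (fps_exp 1 - 1) oo fps_ln 1 oo f"
    by (rule fps_compose_assoc) (use assms in simp_all)
  also have "\<dots> = f"
    using assms fps_inv_fps_exp_compose(2)[of "1::'a"] by (simp add: fps_ln_fps_exp_inv)
  finally show ?thesis
    by (simp add: fps_compose_sub_distrib algebra_simps)
qed

lemma hadamard_nth [simp]: "(f \<odot> g) $ n = f $ n * g $ n"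
  by (simp add: hadamard_def)

lemma hadamard_add_right: "f \<odot> (g + h) = f \<odot> g + f \<odot> (h :: 'a::semiring fps)"
  by (simp add: fps_eq_iff distrib_left)

text \<open>The logarithmic derivative term is the geometric series of \<open>(a t)^n\<close> over
  \<open>n \<ge> 1\<close>. Its Hadamard product with \<open>R\<close> scales coefficient
  \<open>n\<close> by \<open>a^n\<close>, and \<open>R $ 0 = 0\<close> matches the missing constant
  term.\<close>

lemma hadamard_logderiv_linear:
  fixes R :: "'a::field fps"
  assumes "R $ 0 = 0"
  shows "R \<odot> (- fps_X * fps_deriv (1 - fps_const a * fps_X) / (1 - fps_const a * fps_X)) =
    R oo (fps_const a * fps_X)"
proof -
  define G where "G = Abs_fps (\<lambda>n. if n = 0 then 0 else a ^ n)"
  have "G * (1 - fps_const a * fps_X) = G - fps_const a * (G * fps_X)"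
    by (simp add: algebra_simps)
  also have "\<dots> = fps_const a * fps_X"
  proof (rule fps_ext)
    fix n
    show "(G - fps_const a * (G * fps_X)) $ n = (fps_const a * fps_X) $ n"
      \<comment> \<open>The cases \<open>n = 0\<close> and \<open>n = 1\<close> stand apart because
        \<open>G\<close> starts at index 1.\<close>
      by (cases n; cases "n - 1") (simp_all add: G_def)
  qed
  also have "\<dots> = - fps_X * fps_deriv (1 - fps_const a * fps_X)"
    by simp
  finally have "- fps_X * fps_deriv (1 - fps_const a * fps_X) / (1 - fps_const a * fps_X) =
      G * (1 - fps_const a * fps_X) / (1 - fps_const a * fps_X)"
    by simp
  moreover have "1 - fps_const a * fps_X \<noteq> 0"
    by (rule fps_nonzeroI[of _ 0]) simp
  ultimately have "- fps_X * fps_deriv (1 - fps_const a * fps_X) / (1 - fps_const a * fps_X) = G"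
    by (metis nonzero_mult_div_cancel_right)
  then show ?thesis
    using assms by (auto simp: fps_eq_iff G_def)
qed

lemma logderiv_mult:
  fixes f g :: "'a::field fps"
  assumes "f $ 0 \<noteq> 0" "g $ 0 \<noteq> 0"
  shows "- fps_X * fps_deriv (f * g) / (f * g) =
    - fps_X * fps_deriv f / f + - fps_X * fps_deriv g / g"
proof -
  have "- fps_X * fps_deriv (f * g) / (f * g) =
      - fps_X * ((f * inverse f) * (fps_deriv g * inverse g) +
        (g * inverse g) * (fps_deriv f * inverse f))"
    using assms by (simp add: fps_divide_unit fps_inverse_mult algebra_simps)
  also have "\<dots> = - fps_X * fps_deriv f / f + - fps_X * fps_deriv g / g"
    unfolding inverse_mult_eq_1'[OF assms(1)] inverse_mult_eq_1'[OF assms(2)]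
    using assms by (simp add: fps_divide_unit algebra_simps)
  finally show ?thesis .
qed

text \<open>Each linear factor of \<open>E\<close> adds \<open>R(a t)\<close> to the Hadamard
  product; the exponential turns the sum into a product with factors
  \<open>exp (R(a t)) = Q(a t)\<close>.\<close>

lemma exp_hadamard_ln_logderiv_prod:
  fixes Q :: "'a::field_char_0 fps" and a :: "'i \<Rightarrow> 'a"
  assumes "finite I" and Q: "Q $ 0 = 1"
  defines "R \<equiv> fps_ln 1 oo (Q - 1)" and "E \<equiv> \<Prod>i\<in>I. 1 - fps_const (a i) * fps_X"
  shows "fps_exp 1 oo (R \<odot> (- fps_X * fps_deriv E / E)) = (\<Prod>i\<in>I. Q oo (fps_const (a i) * fps_X))"
  using assms(1) unfolding E_def
proof (induction I)
  case empty
  then show ?case by (simp add: fps_eq_iff hadamard_def flip: fps_zero_def)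
next
  case (insert i I)
  let ?F = "1 - fps_const (a i) * fps_X" and ?G = "\<Prod>i\<in>I. 1 - fps_const (a i) * fps_X"
  have R: "R $ 0 = 0"
    by (simp add: R_def)
  have "?G $ 0 = 1"
    using insert.hyps(1) by (induction I) simp_all
  then have "R \<odot> (- fps_X * fps_deriv (?F * ?G) / (?F * ?G)) =
      (R oo (fps_const (a i) * fps_X)) + R \<odot> (- fps_X * fps_deriv ?G / ?G)"
    by (subst logderiv_mult) (simp_all only: hadamard_add_right hadamard_logderiv_linear[OF R], simp_all)
  moreover have "fps_exp 1 oo (R oo (fps_const (a i) * fps_X)) = Q oo (fps_const (a i) * fps_X)"
    using Q R by (subst fps_compose_assoc) (simp_all add: R_def fps_exp_compose_ln_compose)
  ultimately show ?case
    using insert R by (simp add: fps_exp_compose_add)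
qed

section \<open>Substituting the Chern roots into power series\<close>

text \<open>
  The substitution of roots for Chern classes is defined on polynomials only, not on their
  fractions, so it is extended to power series over the field of fractions as a relation. The
  bound \<open>n \<le> d\<close> accounts for the restriction to the variables \<open>c\<^sub>1, \<dots>, c\<^sub>d\<close>.
\<close>

definition chern_rel :: "nat \<Rightarrow> mfrac \<Rightarrow> mfrac \<Rightarrow> bool" where
  "chern_rel d a b \<longleftrightarrow> (\<exists>p. a = to_fract p \<and> rewritten_in_chern d b p)"

definition fps_chern_rel :: "nat \<Rightarrow> mfrac fps \<Rightarrow> mfrac fps \<Rightarrow> bool" where
  "fps_chern_rel d f g \<longleftrightarrow> (\<forall>n\<le>d. chern_rel d (f $ n) (g $ n))"

section \<open>Closure of the coefficient relation under field constants and ring operations\<close>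

lemma chern_relI:
  assumes "pvars p \<subseteq> {Fund, Divi} \<union> Chern ` {1..d}"
  shows "chern_rel d (to_fract p) (to_fract (psubst (chern_to_roots d) p))"
  using assms unfolding chern_rel_def rewritten_in_chern_def by blast

lemma chern_relE:
  assumes "chern_rel d a b"
  obtains p where "pvars p \<subseteq> {Fund, Divi} \<union> Chern ` {1..d}"
    "a = to_fract p" "b = to_fract (psubst (chern_to_roots d) p)"
  using assms unfolding chern_rel_def rewritten_in_chern_def by blast

lemma chern_rel_const: "chern_rel d (to_fract (pconst k)) (to_fract (pconst k))"
  using chern_relI[of "pconst k" d] by simp

lemma chern_rel_0: "chern_rel d 0 0"
  and chern_rel_1: "chern_rel d 1 1"
  using chern_rel_const[of d 0] chern_rel_const[of d 1] by simp_all

lemma chern_rel_fvar: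
  assumes "v = Fund \<or> v = Divi"
  shows "chern_rel d (fvar v) (fvar v)"
  using chern_relI[of "pvar v" d] assms by (auto simp: fvar_def)

lemma chern_rel_Chern:
  assumes "1 \<le> i" "i \<le> d"
  shows "chern_rel d (fvar (Chern i)) (to_fract (elem_sym_roots d i))"
  using chern_relI[of "pvar (Chern i)" d] assms by (simp add: fvar_def)

lemma chern_rel_add:
  assumes "chern_rel d a b" "chern_rel d a' b'"
  shows "chern_rel d (a + a') (b + b')"
proof -
  obtain p where p: "pvars p \<subseteq> {Fund, Divi} \<union> Chern ` {1..d}"
    "a = to_fract p" "b = to_fract (psubst (chern_to_roots d) p)"
    using assms(1) by (rule chern_relE)
  obtain q where q: "pvars q \<subseteq> {Fund, Divi} \<union> Chern ` {1..d}"
    "a' = to_fract q" "b' = to_fract (psubst (chern_to_roots d) q)"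
    using assms(2) by (rule chern_relE)
  have "pvars (p + q) \<subseteq> {Fund, Divi} \<union> Chern ` {1..d}"
    using p(1) q(1) pvars_add[of p q] by (meson Un_least order_trans)
  from chern_relI[OF this] show ?thesis
    by (simp only: p q psubst_add to_fract_add)
qed

lemma chern_rel_mult:
  assumes "chern_rel d a b" "chern_rel d a' b'"
  shows "chern_rel d (a * a') (b * b')"
proof -
  obtain p where p: "pvars p \<subseteq> {Fund, Divi} \<union> Chern ` {1..d}"
    "a = to_fract p" "b = to_fract (psubst (chern_to_roots d) p)"
    using assms(1) by (rule chern_relE)
  obtain q where q: "pvars q \<subseteq> {Fund, Divi} \<union> Chern ` {1..d}"
    "a' = to_fract q" "b' = to_fract (psubst (chern_to_roots d) q)"
    using assms(2) by (rule chern_relE)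
  have "pvars (p * q) \<subseteq> {Fund, Divi} \<union> Chern ` {1..d}"
    using p(1) q(1) pvars_mult[of p q] by (meson Un_least order_trans)
  from chern_relI[OF this] show ?thesis
    by (simp only: p q psubst_mult to_fract_mult)
qed

lemma chern_rel_uminus:
  assumes "chern_rel d a b"
  shows "chern_rel d (- a) (- b)"
  using chern_rel_mult[OF chern_rel_const[of d "- 1"] assms] by (simp add: pconst_uminus)

lemma chern_rel_sum:
  assumes "\<And>x. x \<in> A \<Longrightarrow> chern_rel d (f x) (g x)"
  shows "chern_rel d (sum f A) (sum g A)"
  using assms by (induction A rule: infinite_finite_induct) (simp_all add: chern_rel_0 chern_rel_add)

lemma chern_rel_power:
  assumes "chern_rel d a b"
  shows "chern_rel d (a ^ n) (b ^ n)"
  by (induction n) (simp_all add: chern_rel_1 chern_rel_mult assms)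

lemma of_nat_eq_to_fract_pconst: "(of_nat n :: mfrac) = to_fract (pconst (of_nat n))"
  by (induction n) (simp_all add: pconst_add)

text \<open>Inverting a ground constant does not leave the polynomials. This covers the denominators
  of the exponential and logarithm series.\<close>

lemma to_fract_pconst_inverse: "inverse (to_fract (pconst k)) = to_fract (pconst (inverse k))"
proof (cases "k = 0")
  case False
  then have "pconst k * pconst (inverse k) = 1"
    by (simp flip: pconst_mult)
  then have "to_fract (pconst k) * to_fract (pconst (inverse k)) = 1"
    by (metis to_fract_1 to_fract_mult)
  then show ?thesis
    by (rule inverse_unique)
qed simp

lemma chern_rel_of_nat: "chern_rel d (of_nat n) (of_nat n)"
  and chern_rel_inverse_of_nat: "chern_rel d (inverse (of_nat n)) (inverse (of_nat n))"
  by (simp_all only: of_nat_eq_to_fract_pconst to_fract_pconst_inverse chern_rel_const)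

lemma chern_rel_fy: "chern_rel d fy fy"
  by (simp only: fy_def chern_rel_const)

text \<open>The nonzero constants from the ground field: they are fixed by the substitution, and so
  are their inverses. As constant terms they allow division of series with polynomial
  coefficients.\<close>

definition ground_unit :: "mfrac \<Rightarrow> bool" where
  "ground_unit a \<longleftrightarrow> (\<exists>k. k \<noteq> 0 \<and> a = to_fract (pconst k))"

lemma ground_unit_neq_0: "ground_unit a \<Longrightarrow> a \<noteq> 0"
  by (auto simp: ground_unit_def)

lemma chern_rel_inverse_ground_unit: "ground_unit a \<Longrightarrow> chern_rel d (inverse a) (inverse a)"
  by (auto simp: ground_unit_def to_fract_pconst_inverse chern_rel_const)

lemma ground_unit_1: "ground_unit 1"
  unfolding ground_unit_def by (rule exI[of _ 1]) simp

lemma ground_unit_mult: "ground_unit a \<Longrightarrow> ground_unit b \<Longrightarrow> ground_unit (a * b)"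
  unfolding ground_unit_def by (metis mult_eq_0_iff pconst_mult to_fract_mult)

lemma ground_unit_power: "ground_unit a \<Longrightarrow> ground_unit (a ^ n)"
  by (induction n) (simp_all add: ground_unit_1 ground_unit_mult)

text \<open>Since \<open>y\<close> is an indeterminate, \<open>1 + y\<close> is a nonzero polynomial
  in it.\<close>

lemma ground_unit_1_fy: "ground_unit (1 + fy)"
  unfolding ground_unit_def
proof (intro exI conjI)
  have "1 + hirzebruch_y = to_fract [:1, 1:]"
    by (simp add: hirzebruch_y_def one_pCons flip: to_fract_1 to_fract_add)
  then show "1 + hirzebruch_y \<noteq> 0"
    by simp
  show "1 + fy = to_fract (pconst (1 + hirzebruch_y))"
    by (simp add: fy_def pconst_add)
qed

lemma ground_unit_fy_1: "ground_unit (fy + 1)"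
  using ground_unit_1_fy by (simp add: add.commute)

section \<open>Closure of the relation on power series\<close>

lemma fps_chern_rel_const: "chern_rel d a b \<Longrightarrow> fps_chern_rel d (fps_const a) (fps_const b)"
  by (simp add: fps_chern_rel_def chern_rel_0)

lemma fps_chern_rel_1: "fps_chern_rel d 1 1"
  and fps_chern_rel_X: "fps_chern_rel d fps_X fps_X"
  by (simp_all add: fps_chern_rel_def chern_rel_0 chern_rel_1 fps_X_def)

lemma fps_chern_rel_numeral: "fps_chern_rel d (numeral k) (numeral k)"
  unfolding numeral_fps_const using chern_rel_of_nat[of d "numeral k"]
  by (intro fps_chern_rel_const) simp

lemma fps_chern_rel_uminus: "fps_chern_rel d f g \<Longrightarrow> fps_chern_rel d (- f) (- g)"
  by (simp add: fps_chern_rel_def chern_rel_uminus)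

lemma fps_chern_rel_add:
  "fps_chern_rel d f g \<Longrightarrow> fps_chern_rel d f' g' \<Longrightarrow> fps_chern_rel d (f + f') (g + g')"
  by (simp add: fps_chern_rel_def chern_rel_add)

lemma fps_chern_rel_diff:
  "fps_chern_rel d f g \<Longrightarrow> fps_chern_rel d f' g' \<Longrightarrow> fps_chern_rel d (f - f') (g - g')"
  using fps_chern_rel_add[of d f g "- f'" "- g'"] by (simp add: fps_chern_rel_uminus)

lemma fps_chern_rel_mult:
  "fps_chern_rel d f g \<Longrightarrow> fps_chern_rel d f' g' \<Longrightarrow> fps_chern_rel d (f * f') (g * g')"
  by (auto simp: fps_chern_rel_def fps_mult_nth intro!: chern_rel_sum chern_rel_mult)

lemma fps_chern_rel_power: "fps_chern_rel d f g \<Longrightarrow> fps_chern_rel d (f ^ n) (g ^ n)"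
  by (induction n) (simp_all add: fps_chern_rel_1 fps_chern_rel_mult)

lemma fps_chern_rel_hadamard:
  "fps_chern_rel d f g \<Longrightarrow> fps_chern_rel d f' g' \<Longrightarrow> fps_chern_rel d (f \<odot> f') (g \<odot> g')"
  by (simp add: fps_chern_rel_def chern_rel_mult)

text \<open>Coefficient \<open>n\<close> of a composition is a finite sum of coefficients
  \<open>i \<le> n\<close> of \<open>f\<close> times coefficients \<open>n\<close> of powers of
  \<open>f'\<close>, so the bound \<open>d\<close> is respected.\<close>

lemma fps_chern_rel_compose:
  assumes "fps_chern_rel d f g" "fps_chern_rel d f' g'"
  shows "fps_chern_rel d (f oo f') (g oo g')"
  using assms(1) fps_chern_rel_power[OF assms(2)]
  by (auto simp: fps_chern_rel_def fps_compose_nth intro!: chern_rel_sum chern_rel_mult)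

text \<open>The derivative alone would require coefficient \<open>d + 1\<close>; the factor
  \<open>fps_X\<close> shifts the index back.\<close>

lemma fps_chern_rel_X_deriv:
  assumes "fps_chern_rel d f g"
  shows "fps_chern_rel d (fps_X * fps_deriv f) (fps_X * fps_deriv g)"
proof -
  have "(fps_X * fps_deriv h) $ n = of_nat n * h $ n" for h :: "mfrac fps" and n
    by (cases n) simp_all
  then show ?thesis
    using assms unfolding fps_chern_rel_def by (auto intro: chern_rel_mult chern_rel_of_nat)
qed

text \<open>Strong induction along the recursion for the coefficients of an inverse, in which the
  only division is by the constant term.\<close>

lemma fps_chern_rel_inverse:
  assumes "fps_chern_rel d f g" "f $ 0 = g $ 0" "ground_unit (g $ 0)"
  shows "fps_chern_rel d (inverse f) (inverse g)"
proof -
  have "n \<le> d \<longrightarrow> chern_rel d (natfun_inverse f n) (natfun_inverse g n)" for n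
  proof (induction n rule: less_induct)
    case (less n)
    show ?case
    proof (cases n)
      case 0
      then show ?thesis
        using assms by (simp add: chern_rel_inverse_ground_unit)
    next
      case (Suc m)
      show ?thesis
      proof
        assume "n \<le> d"
        have "chern_rel d (- inverse (f $ 0) * (\<Sum>i = 1..n. f $ i * natfun_inverse f (n - i)))
          (- inverse (g $ 0) * (\<Sum>i = 1..n. g $ i * natfun_inverse g (n - i)))"
          using assms less.IH \<open>n \<le> d\<close>
          by (intro chern_rel_mult chern_rel_uminus chern_rel_sum)
            (auto simp: fps_chern_rel_def chern_rel_inverse_ground_unit)
        then show "chern_rel d (natfun_inverse f n) (natfun_inverse g n)"
          using Suc by (simp add: fps_right_inverse_constructor_rec)
      qed
    qed
  qed
  then show ?thesis
    by (simp add: fps_chern_rel_def fps_inverse_def)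
qed

lemma fps_chern_rel_divide:
  assumes "fps_chern_rel d f g" "fps_chern_rel d f' g'" "f' $ 0 = g' $ 0" "ground_unit (g' $ 0)"
  shows "fps_chern_rel d (f / f') (g / g')"
  using assms by (simp add: fps_divide_unit ground_unit_neq_0 fps_chern_rel_mult fps_chern_rel_inverse)

lemma fps_chern_rel_exp:
  assumes "chern_rel d a b"
  shows "fps_chern_rel d (fps_exp a) (fps_exp b)"
proof -
  have "chern_rel d (a ^ n * inverse (of_nat (fact n))) (b ^ n * inverse (of_nat (fact n)))" for n
    by (intro chern_rel_mult chern_rel_power assms chern_rel_inverse_of_nat)
  then show ?thesis
    by (simp add: fps_chern_rel_def divide_inverse)
qed

lemma fps_chern_rel_ln_1: "fps_chern_rel d (fps_ln 1) (fps_ln 1)"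
proof -
  have "chern_rel d ((- 1) ^ (n - 1) * inverse (of_nat n)) ((- 1) ^ (n - 1) * inverse (of_nat n))" for n
    by (intro chern_rel_mult chern_rel_power chern_rel_uminus chern_rel_1 chern_rel_inverse_of_nat)
  then show ?thesis
    by (simp add: fps_chern_rel_def fps_ln_nth divide_inverse chern_rel_0)
qed

section \<open>The series in the formula\<close>

text \<open>Cancelling \<open>t\<close> leaves a denominator with constant term
  \<open>1 + y\<close>, to which \<open>fps_chern_rel_divide\<close> applies.\<close>

lemma hirzebruch_Q_conv_unit_divide:
  "hirzebruch_Q = fps_const (1 + fy) / fps_shift 1 (1 - fps_exp (- (1 + fy))) - fps_const fy * fps_X"
proof -
  define D where "D = fps_shift 1 (1 - fps_exp (- (1 + fy)))"
  have "1 - fps_exp (- (1 + fy)) = fps_X * D"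
    by (rule fps_ext) (simp add: D_def)
  then have "fps_X * fps_const (1 + fy) / (1 - fps_exp (- (1 + fy))) = fps_const (1 + fy) / D"
    by simp
  then show ?thesis
    by (simp only: hirzebruch_Q_def D_def)
qed

lemma hirzebruch_Q_nth_0: "hirzebruch_Q $ 0 = 1"
proof -
  define D where "D = fps_shift 1 (1 - fps_exp (- (1 + fy)))"
  have "D $ 0 = 1 + fy"
    by (simp add: D_def)
  then show ?thesis
    using ground_unit_neq_0[OF ground_unit_1_fy]
    unfolding hirzebruch_Q_conv_unit_divide D_def[symmetric] by simp
qed

lemma fps_chern_rel_hirzebruch_Q: "fps_chern_rel d hirzebruch_Q hirzebruch_Q"
proof -
  let ?D = "fps_shift 1 (1 - fps_exp (- (1 + fy)))"
  \<comment> \<open>Coefficient \<open>n\<close> of \<open>?D\<close> is coefficient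
    \<open>Suc n\<close> of the unshifted series, which for \<open>n = d\<close> lies beyond the
    bound; hence the explicit coefficients.\<close>
  have "chern_rel d (- ((- (1 + fy)) ^ Suc n * inverse (of_nat (fact (Suc n)))))
      (- ((- (1 + fy)) ^ Suc n * inverse (of_nat (fact (Suc n)))))" for n
    by (intro chern_rel_mult chern_rel_power chern_rel_uminus chern_rel_add chern_rel_1
        chern_rel_fy chern_rel_inverse_of_nat)
  then have "fps_chern_rel d ?D ?D"
    by (simp only: fps_chern_rel_def fps_shift_nth fps_sub_nth fps_exp_nth fps_one_nth
        divide_inverse of_nat_fact Suc_eq_plus1 add_eq_0_iff_both_eq_0 one_neq_zero simp_thms if_False
        diff_0)
  moreover have "ground_unit (?D $ 0)"
    using ground_unit_fy_1 by simp
  ultimately show ?thesis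
    unfolding hirzebruch_Q_conv_unit_divide
    by (intro fps_chern_rel_diff fps_chern_rel_divide fps_chern_rel_const fps_chern_rel_mult
        chern_rel_add chern_rel_1 chern_rel_fy fps_chern_rel_X refl)
qed

lemma fps_chern_rel_hirzebruch_R: "fps_chern_rel d hirzebruch_R hirzebruch_R"
  unfolding hirzebruch_R_def
  by (intro fps_chern_rel_compose fps_chern_rel_ln_1 fps_chern_rel_diff fps_chern_rel_hirzebruch_Q
      fps_chern_rel_1)

text \<open>The substitution fixes \<open>L\<close>, \<open>S\<close> and \<open>y\<close>. At
  \<open>t = 0\<close> both \<open>l\<close> and \<open>s\<close> are 1, so every denominator has a
  product of factors \<open>1 + y\<close> as its constant term.\<close>

lemma fps_chern_rel_fibration_series:
  "fps_chern_rel d (fibration_series Y) (fibration_series Y)"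
proof -
  define y l s where "y = fps_const fy" and "l = fps_exp ((1 + fy) * fvar Fund)"
    and "s = fps_exp ((1 + fy) * fvar Divi)"
  have rel: "fps_chern_rel d y y" "fps_chern_rel d l l" "fps_chern_rel d s s"
    unfolding y_def l_def s_def
    by (intro fps_chern_rel_const fps_chern_rel_exp chern_rel_mult chern_rel_add chern_rel_1
        chern_rel_fy chern_rel_fvar; simp)+
  have nth_0: "y $ 0 = fy" "l $ 0 = 1" "s $ 0 = 1"
    by (simp_all add: y_def l_def s_def)
  show ?thesis
    unfolding fibration_series_def y_def[symmetric] l_def[symmetric] s_def[symmetric]
    by (cases Y; simp only: fibration_Q.simps;
      intro fps_chern_rel_add fps_chern_rel_diff fps_chern_rel_mult fps_chern_rel_divide
        fps_chern_rel_power fps_chern_rel_numeral fps_chern_rel_1 rel refl;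
      simp add: nth_0 ground_unit_mult ground_unit_power ground_unit_1_fy ground_unit_fy_1
        fps_nth_power_0)
qed

text \<open>Vieta's formula: expanding the product over subsets \<open>I\<close> of
  \<open>{1..d}\<close>, only those of size \<open>n\<close> contribute to coefficient
  \<open>n\<close>.\<close>

lemma prod_root_factors_nth:
  "(\<Prod>i = 1..d. 1 - fps_const (fvar (Root i)) * fps_X) $ n = (- 1) ^ n * to_fract (elem_sym_roots d n)"
proof -
  have fin: "finite {1..d}"
    by simp
  have prod: "(\<Prod>i\<in>I. fps_const (fvar (Root i)) * fps_X) =
      fps_const (to_fract (\<Prod>i\<in>I. pvar (Root i))) * fps_X ^ card I" if "finite I" for I
    using that by induction (simp_all add: fvar_def mult_ac)
  have "(\<Prod>i = 1..d. 1 - fps_const (fvar (Root i)) * fps_X) $ n =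
      (\<Sum>I\<in>Pow {1..d}. ((- 1) ^ card I * (\<Prod>i\<in>I. fps_const (fvar (Root i)) * fps_X)) $ n)"
    by (simp only: prod_diff_conv_sum[OF fin] fps_sum_nth prod.neutral_const mult_1_right)
  also have "\<dots> = (\<Sum>I\<in>Pow {1..d}.
      if card I = n then (- 1) ^ n * to_fract (\<Prod>i\<in>I. pvar (Root i)) else 0)"
  proof (rule sum.cong[OF refl])
    fix I
    assume "I \<in> Pow {1..d}"
    then have "finite I"
      using finite_subset by blast
    then show "((- 1) ^ card I * (\<Prod>i\<in>I. fps_const (fvar (Root i)) * fps_X)) $ n =
        (if card I = n then (- 1) ^ n * to_fract (\<Prod>i\<in>I. pvar (Root i)) else 0)"
      \<comment> \<open>The parity of \<open>card I\<close> decides the sign, here a power of the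
        series \<open>- 1\<close>.\<close>
      by (cases "even (card I)") (auto simp: prod)
  qed
  also have "\<dots> = (- 1) ^ n * to_fract (elem_sym_roots d n)"
    by (simp add: elem_sym_roots_def sum_distrib_left sum.If_cases Pow_def Collect_conj_eq)
  finally show ?thesis .
qed

lemma fps_chern_rel_chern_C:
  "fps_chern_rel d chern_C (\<Prod>i = 1..d. 1 - fps_const (fvar (Root i)) * fps_X)"
  unfolding fps_chern_rel_def
proof (intro allI impI)
  fix n
  assume "n \<le> d"
  have "chern_rel d (if n = 0 then 1 else fvar (Chern n)) (to_fract (elem_sym_roots d n))"
    using \<open>n \<le> d\<close> chern_rel_Chern[of n d] chern_rel_1[of d] by simp
  then show "chern_rel d (chern_C $ n)
      ((\<Prod>i = 1..d. 1 - fps_const (fvar (Root i)) * fps_X) $ n)"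
    unfolding prod_root_factors_nth chern_C_def fps_nth_Abs_fps
    by (intro chern_rel_mult chern_rel_power chern_rel_uminus chern_rel_1)
qed

section \<open>Comparison with the formula in the Chern roots\<close>

lemma chern_rel_chi_roots:
  "chern_rel d ((fibration_series Y *
      (fps_exp 1 oo (hirzebruch_R \<odot> (- fps_X * fps_deriv chern_C / chern_C)))) $ d) (chi_roots Y d)"
proof -
  let ?E = "\<Prod>i = 1..d. 1 - fps_const (fvar (Root i)) * fps_X"
  have nth_0: "chern_C $ 0 = 1" "?E $ 0 = 1"
    by (simp add: chern_C_def) (simp only: prod_root_factors_nth elem_sym_roots_0, simp)
  \<comment> \<open>\<open>- fps_X * f\<close> parses as \<open>(- fps_X) * f\<close>; regrouping
    exposes the product handled by \<open>fps_chern_rel_X_deriv\<close>.\<close>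
  have minus: "- fps_X * fps_deriv f = - (fps_X * fps_deriv f)" for f :: "mfrac fps"
    by simp
  have "fps_chern_rel d
      (fibration_series Y * (fps_exp 1 oo (hirzebruch_R \<odot> (- fps_X * fps_deriv chern_C / chern_C))))
      (fibration_series Y * (fps_exp 1 oo (hirzebruch_R \<odot> (- fps_X * fps_deriv ?E / ?E))))"
    unfolding minus
    by (intro fps_chern_rel_mult fps_chern_rel_compose fps_chern_rel_hadamard fps_chern_rel_divide
        fps_chern_rel_uminus fps_chern_rel_X_deriv fps_chern_rel_chern_C fps_chern_rel_exp chern_rel_1
        fps_chern_rel_hirzebruch_R fps_chern_rel_fibration_series)
      (simp_all only: nth_0 ground_unit_1)
  \<comment> \<open>For the product over the roots the exponential formula is exact; the truncation
    at order \<open>d\<close> enters only through \<open>chern_C\<close>.\<close>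
  moreover have "fps_exp 1 oo (hirzebruch_R \<odot> (- fps_X * fps_deriv ?E / ?E)) =
      (\<Prod>i = 1..d. hirzebruch_Q oo (fps_const (fvar (Root i)) * fps_X))"
    unfolding hirzebruch_R_def
    by (rule exp_hadamard_ln_logderiv_prod) (simp_all add: hirzebruch_Q_nth_0)
  ultimately show ?thesis
    by (simp only: chi_roots_def fps_chern_rel_def order_refl)
qed

theorem theorem6p2:
  fixes Y :: fibration and \<chi> :: "mfrac fps"
  shows "is_stringy_chi_y_series Y \<chi> \<longleftrightarrow>
    \<chi> = fibration_series Y *
      (fps_exp 1 oo (hirzebruch_R \<odot> (- fps_X * fps_deriv chern_C / chern_C)))"
    (is "_ \<longleftrightarrow> \<chi> = ?F")
proof
  assume "is_stringy_chi_y_series Y \<chi>"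
  then have "chern_rel d (\<chi> $ d) (chi_roots Y d)" for d
    by (simp only: is_stringy_chi_y_series_def chern_rel_def)
  moreover have "chern_rel d (?F $ d) (chi_roots Y d)" for d
    by (rule chern_rel_chi_roots)
  \<comment> \<open>Both coefficients rewrite the same expression in the roots, so uniqueness
    identifies them.\<close>
  ultimately have "\<chi> $ d = ?F $ d" for d
    unfolding chern_rel_def by (metis rewritten_in_chern_unique)
  then show "\<chi> = ?F"
    by (rule fps_ext)
next
  assume "\<chi> = ?F"
  then show "is_stringy_chi_y_series Y \<chi>"
    using chern_rel_chi_roots[of _ Y] by (simp add: is_stringy_chi_y_series_def chern_rel_def)
qed

end
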